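(* Let $m$ be a positive integer and $g$ a divisor of $m$ with $s_g(m)\ge g$ (so $m\in\mathcal{S}'_{\mathcal L}$). Then: (i) $m$ has at least two distinct prime divisors; (ii) if $m$ is a Carmichael number with exactly three prime factors, then $g$ is an odd prime; (iii) $1<g<m^{1/(\operatorname{ord}_g(m)+1)}\le\sqrt m$.
   Context: For an integer base $g\ge 2$ and integer $m\ge 0$, $s_g(m)$ denotes the sum of the base-$g$ digits of $m$; by convention $s_1(m):=0$. For integers $g\ge 2$, $m\ge1$, $\operatorname{ord}_g(m):=\max\{n\ge0:g^n\mid m\}$. $\mathcal{S}'_{\mathcal L}$ denotes the set of positive integers $m$ having a divisor $g$ with $s_g(m)\ge g$. A Carmichael number is a composite positive integer $m$ with $a^{m-1}\equiv1\pmod m$ for all integers $a$ coprime to $m$. *)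

theory Defs
  imports Complex_Main "HOL-Number_Theory.Number_Theory"
begin

(* Base-g digits, least significant first. The recursion is meaningful only for g >= 2;
   for g <= 1 the list is empty, which yields the convention s_1(m) = 0 below. *)
fun digits :: "nat \<Rightarrow> nat \<Rightarrow> nat list" where
  "digits g m = (if g < 2 \<or> m = 0 then [] else (m mod g) # digits g (m div g))"

declare digits.simps [simp del]

definition digit_sum :: "nat \<Rightarrow> nat \<Rightarrow> nat" where
  "digit_sum g m = sum_list (digits g m)"

definition carmichael :: "nat \<Rightarrow> bool" where
  "carmichael m \<longleftrightarrow> m > 1 \<and> \<not> prime m \<and>
     (\<forall>a :: int. coprime a (int m) \<longrightarrow> [a ^ (m - 1) = 1] (mod int m))"

definition S_L' :: "nat set" where
  "S_L' = {m. m > 0 \<and> (\<exists>g. g dvd m \<and> digit_sum g m \<ge> g)}"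

lemma digit_sum_1: "digit_sum 1 m = 0"
  by (simp add: digit_sum_def digits.simps)

lemma digits_less: "g \<ge> 2 \<Longrightarrow> d \<in> set (digits g m) \<Longrightarrow> d < g"
  by (induction g m rule: digits.induct) (subst (asm) (2) digits.simps, auto split: if_splits)

lemma digits_expansion: "g \<ge> 2 \<Longrightarrow> horner_sum id g (digits g m) = m"
  by (induction g m rule: digits.induct) (subst digits.simps, auto)

(* ord_g(m) is the library's multiplicity. *)
lemma multiplicity_eq_Max:
  fixes g m :: nat
  assumes "g \<ge> 2" "m \<ge> 1"
  shows "multiplicity g m = Max {n. g ^ n dvd m}"
  using assms finite_divisor_powers[of m g] by (simp add: multiplicity_def)

end

theory Submission
  imports Defs "HOL-Computational_Algebra.Squarefree"
begin

text \<open>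
  Write \<open>m = g ^ e * k\<close> with \<open>g\<close> not dividing \<open>k\<close>. The factor \<open>g ^ e\<close> only contributes trailing
  zeros, so \<open>k\<close> has digit sum at least \<open>g\<close>, which rules out one-digit \<open>k\<close>: hence \<open>g < k\<close>. This
  gives \<open>g ^ (e + 1) < m\<close>, and it excludes prime powers \<open>m\<close>, since there \<open>g < k\<close> would force
  \<open>g dvd k\<close>. If \<open>m\<close> is a Carmichael number with three prime factors and \<open>g\<close> is not prime, then
  \<open>m = g * r\<close> with \<open>r\<close> prime and \<open>g < r\<close>; but Korselt's criterion gives that \<open>r - 1\<close> divides
  \<open>m - 1 = g * (r - 1) + (g - 1)\<close>, so \<open>r \<le> g\<close>.
\<close>

section \<open>Digit sums\<close>

lemma digit_sum_less_base: "k < g \<Longrightarrow> digit_sum g k = k"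
  by (cases "g < 2") (auto simp: digit_sum_def digits.simps[of g k] digits.simps[of g 0])

lemma digit_sum_base_mult: "digit_sum g (g * k) = digit_sum g k"
  by (cases "g < 2 \<or> k = 0")
     (auto simp: digit_sum_def digits.simps[of g "g * k"] digits.simps[of g k] digits.simps[of g 0])

lemma digit_sum_base_power_mult: "digit_sum g (g ^ e * k) = digit_sum g k"
  by (induction e) (simp_all add: digit_sum_base_mult mult.assoc)

lemma digit_sum_ge_base_decompose:
  assumes "m > 0" "g dvd m" "digit_sum g m \<ge> g"
  obtains k where "m = g ^ multiplicity g m * k" "\<not> g dvd k" "g < k"
    "1 < g" "0 < multiplicity g m"
proof -
  have "g \<noteq> 0"
    using assms by auto
  \<comment> \<open>By convention the base-1 digit sum is 0, which is below 1.\<close>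
  moreover have "g \<noteq> 1"
    using assms(3) digit_sum_1 by fastforce
  ultimately have g: "1 < g" by simp
  hence "m \<noteq> 0" "\<not> is_unit g"
    using assms(1) by simp_all
  then obtain k where k: "m = g ^ multiplicity g m * k" "\<not> g dvd k"
    by (rule multiplicity_decompose')
  have "digit_sum g k = digit_sum g m"
    by (subst k(1)) (simp add: digit_sum_base_power_mult)
  \<comment> \<open>A \<open>k\<close> below \<open>g\<close> is its own digit sum, hence too small;
    \<open>k = g\<close> is excluded by \<open>\<not> g dvd k\<close>.\<close>
  hence "g < k"
    using assms(3) k(2) digit_sum_less_base[of k g] by (cases k g rule: linorder_cases) auto
  moreover have "0 < multiplicity g m"
    using g assms multiplicity_gt_zero_iff[of m g] by simp
  ultimately show thesis
    using that k g by blast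
qed

section \<open>Prime factors\<close>

lemma card_prime_factors_eq_1E:
  fixes n :: nat
  assumes "card (prime_factors n) = 1"
  obtains p k where "prime p" "n = p ^ k"
proof -
  obtain p where p: "prime_factors n = {p}"
    using assms by (auto simp: card_1_singleton_iff)
  \<comment> \<open>\<open>prime_factors 0\<close> is empty by default, so \<open>n = 0\<close>
    cannot have exactly one prime factor.\<close>
  hence "n \<noteq> 0"
    by (metis empty_not_insert prime_factorization_0 set_mset_empty)
  hence "n = p ^ multiplicity p n"
    using prime_factorization_nat[of n] p by simp
  moreover have "prime p"
    using p by (metis in_prime_factors_imp_prime singletonI)
  ultimately show thesis
    using that by blast
qed

lemma squarefree_card_prime_factors_eq_1_imp_prime:
  fixes n :: nat
  assumes "squarefree n" "card (prime_factors n) = 1"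
  shows "prime n"
proof -
  obtain p k where p: "prime p" "n = p ^ k"
    using card_prime_factors_eq_1E[OF assms(2)] .
  have "\<not> is_unit p"
    using p(1) by auto
  hence "k \<le> 1"
    using assms(1) p(2) by (auto simp: squarefree_power_iff)
  moreover have "n \<noteq> 1"
    using assms(2) by auto
  ultimately show ?thesis
    using p by (cases k) auto
qed

lemma prime_factors_nonempty:
  fixes n :: nat
  assumes "1 < n"
  shows "0 < card (prime_factors n)"
proof -
  obtain p where "prime p" "p dvd n"
    using assms prime_factor_nat[of n] by auto
  hence "p \<in> prime_factors n"
    using assms by (intro prime_factorsI) auto
  thus ?thesis
    using card_gt_0_iff by blast
qed

text \<open>Squarefreeness makes the prime factors of \<open>g\<close> and \<open>k\<close>
  disjoint, so their numbers add up to 3. A composite squarefree \<open>g\<close> takes at least two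
  of them, leaving exactly one for \<open>k\<close>.\<close>

lemma squarefree_three_prime_factors_cofactor_prime:
  fixes m g k :: nat
  assumes "squarefree m" "card (prime_factors m) = 3" "m = g * k" "1 < g" "1 < k" "\<not> prime g"
  shows "prime k"
proof -
  have sf: "squarefree g" "squarefree k"
    using assms(1,3) squarefree_multD by auto
  have "prime_factors g \<inter> prime_factors k = {}"
  proof (rule ccontr)
    assume "prime_factors g \<inter> prime_factors k \<noteq> {}"
    then obtain p where "prime p" "p dvd g" "p dvd k"
      by auto
    hence "p ^ 2 dvd m"
      using assms(3) by (simp add: power2_eq_square mult_dvd_mono)
    thus False
      using squarefreeD[OF assms(1)] \<open>prime p\<close> not_prime_unit by blast
  qed
  moreover have "prime_factors m = prime_factors g \<union> prime_factors k"
    using assms(3-5) by (simp add: prime_factorization_mult)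
  ultimately have "card (prime_factors g) + card (prime_factors k) = 3"
    using assms(2) by (simp add: card_Un_disjoint)
  moreover have "card (prime_factors g) \<noteq> 1"
    using squarefree_card_prime_factors_eq_1_imp_prime[OF sf(1)] assms(6) by blast
  ultimately have "card (prime_factors k) = 1"
    using prime_factors_nonempty[OF assms(4)] prime_factors_nonempty[OF assms(5)] by linarith
  thus ?thesis
    using squarefree_card_prime_factors_eq_1_imp_prime[OF sf(2)] by blast
qed

section \<open>Carmichael numbers\<close>

lemma carmichael_cong_nat:
  fixes a :: nat
  assumes "carmichael m" "coprime a m"
  shows "[a ^ (m - 1) = 1] (mod m)"
proof -
  have "[int a ^ (m - 1) = 1] (mod int m)"
    using assms by (auto simp: carmichael_def)
  thus ?thesis
    by (metis cong_int_iff of_nat_1 of_nat_power)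
qed

text \<open>Test the base -1: for even \<open>m\<close> the exponent \<open>m - 1\<close> is odd, so
  -1 and 1 would agree modulo \<open>m\<close>.\<close>

lemma carmichael_odd:
  assumes "carmichael m"
  shows "odd m"
proof
  assume "even m"
  have m: "1 < m" "\<not> prime m"
    using assms by (auto simp: carmichael_def)
  have "[(- 1) ^ (m - 1) = 1] (mod int m)"
    using assms by (auto simp: carmichael_def)
  moreover have "odd (m - 1)"
    using \<open>even m\<close> m(1) by auto
  ultimately have "[- 1 = 1] (mod int m)"
    by simp
  hence "int m dvd 2"
    by (simp add: cong_iff_dvd_diff)
  hence "m dvd 2"
    by (metis int_dvd_int_iff of_nat_numeral)
  hence "m \<le> 2"
    by (simp add: dvd_imp_le)
  hence "m = 2"
    using m(1) by simp
  thus False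
    using m(2) two_is_prime_nat by simp
qed

lemma carmichael_squarefree:
  assumes "carmichael m"
  shows "squarefree m"
proof (rule squarefreeI)
  fix p :: nat
  assume "p ^ 2 dvd m"
  then obtain c where c: "m = p * (p * c)"
    by (metis dvdE power2_eq_square mult.assoc)
  have m: "1 < m"
    using assms by (simp add: carmichael_def)
  \<comment> \<open>The base \<open>a = 1 + m / p\<close> satisfies \<open>a ^ m = 1\<close> modulo \<open>m\<close>, because \<open>m\<close> divides \<open>(m / p) ^ 2\<close>.\<close>
  define d where "d = p * c"
  have md: "m = p * d" and dd: "m dvd d * d"
    using c by (auto simp: d_def)
  \<comment> \<open>This is the binomial expansion cut off after the linear term, since
    \<open>d * d\<close> vanishes modulo \<open>m\<close>.\<close>
  have pow: "[(1 + d) ^ n = 1 + n * d] (mod m)" for n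
  proof (induction n)
    case (Suc n)
    have "[(1 + d) ^ Suc n = (1 + d) * (1 + n * d)] (mod m)"
      unfolding power_Suc by (rule cong_mult[OF cong_refl Suc])
    also have "(1 + d) * (1 + n * d) = 1 + Suc n * d + n * (d * d)"
      by (simp add: algebra_simps)
    also have "[1 + Suc n * d + n * (d * d) = 1 + Suc n * d + 0] (mod m)"
      by (intro cong_add cong_refl) (use dd in \<open>auto simp: cong_0_iff\<close>)
    finally show ?case by simp
  qed auto
  have "[1 + m * d = 1 + 0] (mod m)"
    by (intro cong_add cong_refl) (simp add: cong_0_iff)
  hence am: "[(1 + d) ^ m = 1] (mod m)"
    using pow[of m] cong_trans by simp
  have "coprime ((1 + d) ^ m) m"
    using am by (metis cong_imp_coprime cong_sym coprime_1_left)
  hence "coprime (1 + d) m"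
    using m by simp
  hence "[(1 + d) ^ (m - 1) = 1] (mod m)"
    by (rule carmichael_cong_nat[OF assms])
  hence "[(1 + d) * (1 + d) ^ (m - 1) = (1 + d) * 1] (mod m)"
    by (intro cong_mult cong_refl)
  moreover have "(1 + d) * (1 + d) ^ (m - 1) = (1 + d) ^ m"
    using m by (simp flip: power_Suc)
  \<comment> \<open>The powers of \<open>1 + d\<close> with exponents \<open>m\<close> and
    \<open>m - 1\<close> are both 1, hence so is \<open>1 + d\<close> itself. Then
    \<open>m = p * d\<close> divides the positive number \<open>d\<close>, which forces
    \<open>p = 1\<close>.\<close>
  ultimately have "[1 + d = 1 + 0] (mod m)"
    using am cong_trans[OF cong_sym] by simp
  hence "m dvd d"
    by (simp only: cong_add_lcancel_nat cong_0_iff)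
  hence "p * d \<le> 1 * d"
    using md m dvd_imp_le[of m d] by (cases "d = 0") auto
  thus "p dvd 1"
    using md m by (cases "p = 0") auto
qed

text \<open>The Chinese remainder theorem lifts a primitive root modulo \<open>r\<close> to a base
  that is 1 modulo the cofactor, hence coprime to \<open>m\<close>. Its order modulo
  \<open>r\<close> is \<open>r - 1\<close>, and it divides \<open>m - 1\<close>.\<close>

lemma carmichael_prime_minus_1_dvd:
  assumes "carmichael m" "prime r" "r dvd m"
  shows "r - 1 dvd m - 1"
proof -
  obtain g where g: "m = r * g"
    using assms(3) by blast
  have "\<not> r dvd g"
  proof
    assume "r dvd g"
    hence "r ^ 2 dvd m"
      using g by (simp add: power2_eq_square)
    thus False
      using squarefreeD[OF carmichael_squarefree[OF assms(1)]] assms(2) not_prime_unit by blast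
  qed
  hence rg: "coprime r g"
    using assms(2) by (simp add: prime_imp_coprime)
  obtain h where h: "residue_primroot r h"
    using prime_primitive_root_exists[of r] assms(2) prime_gt_1_nat[of r] by blast
  obtain a where a: "[a = h] (mod r)" "[a = 1] (mod g)"
    using binary_chinese_remainder_nat[OF rg] by blast
  have "coprime a r"
    using h a(1) by (metis cong_imp_coprime cong_sym coprime_commute residue_primroot_def)
  moreover have "coprime a g"
    using a(2) by (metis cong_imp_coprime cong_sym coprime_1_left)
  ultimately have "[a ^ (m - 1) = 1] (mod m)"
    using carmichael_cong_nat[OF assms(1)] g by simp
  hence "[a ^ (m - 1) = 1] (mod r)"
    using assms(3) cong_dvd_modulus_nat by blast
  hence "[h ^ (m - 1) = 1] (mod r)"
    using a(1) by (meson cong_pow cong_sym cong_trans)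
  hence "ord r h dvd m - 1"
    by (simp only: ord_divides)
  thus ?thesis
    using h assms(2) by (simp add: residue_primroot_def totient_prime)
qed

lemma carmichael_prime_factor_le_cofactor:
  assumes "carmichael (g * r)" "prime r"
  shows "r \<le> g"
proof -
  have r: "1 < r"
    using assms(2) by (rule prime_gt_1_nat)
  \<comment> \<open>For \<open>g = 1\<close> the Carmichael number would be the prime
    \<open>r\<close>. Knowing \<open>g - 1 > 0\<close> later turns divisibility into an
    inequality.\<close>
  have "g * r \<noteq> r"
    using assms by (auto simp: carmichael_def)
  moreover have "0 < g * r"
    using assms(1) unfolding carmichael_def by linarith
  ultimately have g: "1 < g"
    by (cases g "1 :: nat" rule: linorder_cases) auto
  have "g * r - 1 = g * (r - 1) + (g - 1)"
    using r g by (simp add: algebra_simps)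
  moreover have "r - 1 dvd g * r - 1"
    using carmichael_prime_minus_1_dvd[OF assms] by simp
  ultimately have "r - 1 dvd g - 1"
    by (metis dvd_add_right_iff dvd_triv_right)
  hence "r - 1 \<le> g - 1"
    using g by (intro dvd_imp_le) auto
  thus ?thesis
    using g by linarith
qed

theorem theorem2p3:
  fixes m g :: nat
  assumes "m > 0" and "g dvd m" and "digit_sum g m \<ge> g"
  shows "2 \<le> card (prime_factors m) \<and>
         (carmichael m \<and> card (prime_factors m) = 3 \<longrightarrow> prime g \<and> odd g) \<and>
         (1 < g \<and>
          real g < real m powr (1 / (real (multiplicity g m) + 1)) \<and>
          real m powr (1 / (real (multiplicity g m) + 1)) \<le> sqrt (real m))"
proof -
  define e where "e = multiplicity g m"
  obtain k where k: "m = g ^ e * k" "\<not> g dvd k" "g < k" and g: "1 < g" and e: "0 < e"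
    using digit_sum_ge_base_decompose[OF assms] unfolding e_def by blast
  have "1 < m"
    using assms(1,2) g dvd_imp_le[of g m] by linarith

  have "card (prime_factors m) \<noteq> 1"
  proof
    assume "card (prime_factors m) = 1"
    then obtain p n where p: "prime p" "m = p ^ n"
      by (metis card_prime_factors_eq_1E)
    obtain i where i: "g = p ^ i"
      using assms(2) p by (auto simp: divides_primepow_nat)
    have "k dvd p ^ n"
      using k(1) p(2) by (metis dvd_triv_right)
    then obtain j where j: "k = p ^ j"
      using p(1) by (auto simp: divides_primepow_nat)
    \<comment> \<open>Powers of one prime form a chain under divisibility, so \<open>g < k\<close>
      contradicts \<open>\<not> g dvd k\<close>.\<close>
    have "i < j"
      using k(3) i j prime_gt_1_nat[OF p(1)] by (simp add: power_strict_increasing_iff)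
    thus False
      using k(2) i j by (simp add: le_imp_power_dvd)
  qed
  hence "2 \<le> card (prime_factors m)"
    using prime_factors_nonempty[OF \<open>1 < m\<close>] by linarith

  moreover have "prime g \<and> odd g" if car: "carmichael m" and card: "card (prime_factors m) = 3"
  proof
    show "odd g"
      using carmichael_odd[OF car] assms(2) dvd_trans by blast
    \<comment> \<open>Squarefreeness forces \<open>e = 1\<close>, so \<open>k\<close> is the full
      cofactor \<open>m / g\<close>.\<close>
    have "g ^ e dvd m"
      using k(1) by simp
    hence "squarefree (g ^ e)"
      using carmichael_squarefree[OF car] squarefree_mono by blast
    hence "e = 1"
      using g e by (auto simp: squarefree_power_iff)
    hence m: "m = g * k"
      using k(1) by simp
    show "prime g"
    proof (rule ccontr)
      assume "\<not> prime g"
      hence "prime k"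
        using squarefree_three_prime_factors_cofactor_prime[OF carmichael_squarefree[OF car] card m]
          g k(3) by simp
      hence "k \<le> g"
        using carmichael_prime_factor_le_cofactor car m by blast
      thus False
        using k(3) by simp
    qed
  qed

  moreover have "real g < real m powr (1 / (real e + 1))"
  proof -
    \<comment> \<open>One factor \<open>g\<close> is replaced by the larger \<open>k\<close>; the
      bound follows by taking the root of order \<open>e + 1\<close>.\<close>
    have "g ^ Suc e < m"
      using k(1,3) g by simp
    hence "real g ^ Suc e < real m"
      by (metis of_nat_less_iff of_nat_power)
    hence "real g powr (real e + 1) < real m"
      using g powr_realpow[of "real g" "Suc e"] by (simp add: add.commute)
    hence "(real g powr (real e + 1)) powr (1 / (real e + 1)) < real m powr (1 / (real e + 1))"
      by (intro powr_less_mono2) auto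
    thus ?thesis
      using g by (simp add: powr_powr)
  qed

  moreover have "real m powr (1 / (real e + 1)) \<le> sqrt (real m)"
  proof -
    \<comment> \<open>Since \<open>g\<close> divides \<open>m\<close>, \<open>e\<close> is at least
      1, so the exponent is at most 1/2.\<close>
    have "real m powr (1 / (real e + 1)) \<le> real m powr (1 / 2)"
      using e \<open>1 < m\<close> by (intro powr_mono) (auto simp: field_simps)
    thus ?thesis
      by (simp add: powr_half_sqrt)
  qed

  ultimately show ?thesis
    using g unfolding e_def by blast
qed

end
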